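(* Let $n>1$ be an integer and let $X_n$ be the unitary Cayley graph on $\mathbb{Z}_n$, i.e. the simple graph with vertex set $\{0,1,\dots,n-1\}$ in which $a$ and $b$ are adjacent if and only if $\gcd(a-b,n)=1$. Then $X_n$ is $(\Delta(X_n)+2)$-total colorable; that is, $X_n$ has a total coloring using at most $\Delta(X_n)+2$ colors.
   Context: $\Delta(G)$ denotes the maximum degree of a graph $G$. A total coloring of a simple graph $G$ is an assignment of colors to the vertices and edges of $G$ such that no two adjacent or incident elements receive the same color: adjacent vertices get different colors, distinct edges sharing an endpoint get different colors, and each edge gets a color different from those of its two endpoints. *)

theory Defs
  imports "Graph_Theory.Graph_Theory"
begin

text \<open>
  A finite simple graph is a \<^locale>\<open>pair_graph\<close>: the arc set is a symmetric, irreflexive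
  relation, so that each undirected edge is represented by a pair of opposite arcs.
\<close>

definition unitary_cayley_graph :: "nat \<Rightarrow> nat pair_pre_digraph" where
  "unitary_cayley_graph n =
     \<lparr> pverts = {0..<n},
       parcs = {(a, b). a \<in> {0..<n} \<and> b \<in> {0..<n} \<and> gcd (int a - int b) (int n) = 1} \<rparr>"

definition undirected_edges :: "'a pair_pre_digraph \<Rightarrow> 'a set set" where
  "undirected_edges G = {{u, v} | u v. (u, v) \<in> parcs G}"

text \<open>By symmetry, the out-degree of a vertex is the number of its neighbours.\<close>

definition max_degree :: "'a pair_pre_digraph \<Rightarrow> nat" where
  "max_degree G = Max (out_degree (with_proj G) ` pverts G)"

definition total_coloring ::
  "'a pair_pre_digraph \<Rightarrow> ('a \<Rightarrow> 'c) \<Rightarrow> ('a set \<Rightarrow> 'c) \<Rightarrow> bool" where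
  "total_coloring G cV cE \<longleftrightarrow>
     (\<forall>u v. (u, v) \<in> parcs G \<longrightarrow> cV u \<noteq> cV v) \<and>
     (\<forall>e \<in> undirected_edges G. \<forall>f \<in> undirected_edges G.
        e \<noteq> f \<and> e \<inter> f \<noteq> {} \<longrightarrow> cE e \<noteq> cE f) \<and>
     (\<forall>e \<in> undirected_edges G. \<forall>v \<in> e. cE e \<noteq> cV v)"

definition total_colorable :: "'a pair_pre_digraph \<Rightarrow> nat \<Rightarrow> bool" where
  "total_colorable G k \<longleftrightarrow>
     (\<exists>(cV :: 'a \<Rightarrow> nat) (cE :: 'a set \<Rightarrow> nat).
        total_coloring G cV cE \<and>
        cV ` pverts G \<subseteq> {..<k} \<and> cE ` undirected_edges G \<subseteq> {..<k})"

lemma pair_graph_unitary_cayley_graph: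
  assumes "n > 1"
  shows "pair_graph (unitary_cayley_graph n)"
proof -
  let ?P = "parcs (unitary_cayley_graph n)"
  have sub: "?P \<subseteq> {0..<n} \<times> {0..<n}"
    by (auto simp: unitary_cayley_graph_def)
  then have fin: "finite ?P"
    by (rule finite_subset) simp
  have sym: "(b, a) \<in> ?P" if "(a, b) \<in> ?P" for a b
    using that gcd_neg1_int[of "int a - int b" "int n"]
    by (auto simp: unitary_cayley_graph_def)
  have irrefl: "(a, a) \<notin> ?P" for a
    using assms by (auto simp: unitary_cayley_graph_def)
  show ?thesis
  proof
    show "finite (pverts (unitary_cayley_graph n))"
      by (simp add: unitary_cayley_graph_def)
    show "finite ?P" by (rule fin)
    show "fst e \<in> pverts (unitary_cayley_graph n)" if "e \<in> ?P" for e
      using that by (auto simp: unitary_cayley_graph_def)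
    show "snd e \<in> pverts (unitary_cayley_graph n)" if "e \<in> ?P" for e
      using that by (auto simp: unitary_cayley_graph_def)
    show "fst e \<noteq> snd e" if "e \<in> ?P" for e
      using that irrefl by (metis prod.collapse)
    show "symmetric (with_proj (unitary_cayley_graph n))"
      using sym by (auto simp: symmetric_def arcs_ends_def arc_to_ends_def intro!: symI)
  qed
qed

end

theory Submission
  imports Defs "HOL-Library.Transitive_Closure_Table" "HOL-Combinatorics.Transposition"
    "HOL-Computational_Algebra.Primes"
begin

text \<open>
  If \<open>n\<close> is even, the graph is bipartite by parity: the difference modulo \<open>n\<close> of the odd and the
  even endpoint is a proper edge colouring with as many colours as there are units, and two more
  colours serve the vertices.

  If \<open>n\<close> is odd, let \<open>p\<close> be its least prime factor. Differences smaller than \<open>p\<close> are units, so each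
  block of \<open>p\<close> consecutive vertices starting at a multiple of \<open>p\<close> is a clique. Colouring the
  vertex \<open>v\<close> by \<open>2v mod p\<close> and the edge \<open>uv\<close> inside a block by \<open>u + v mod p\<close> uses \<open>p\<close> colours; this
  is proper on all vertices because adjacent vertices differ modulo \<open>p\<close>. The edges between
  blocks form a graph of maximum degree \<open>\<Delta> - (p - 1)\<close>, and Vizing's theorem colours them with
  \<open>\<Delta> - p + 2\<close> further colours.
\<close>

section \<open>Vizing's theorem\<close>

text \<open>The values of \<open>c\<close> outside \<open>E\<close> are unconstrained, so an
  uncoloured edge is simply one outside \<open>E\<close>, and moving it is a change of
  \<open>E\<close>.\<close>

definition edge_coloring :: "'a set set \<Rightarrow> nat \<Rightarrow> ('a set \<Rightarrow> nat) \<Rightarrow> bool" where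
  "edge_coloring E k c \<longleftrightarrow>
     (\<forall>e\<in>E. c e < k) \<and>
     (\<forall>x u v. {x, u} \<in> E \<longrightarrow> {x, v} \<in> E \<longrightarrow> c {x, u} = c {x, v} \<longrightarrow> u = v)"

definition missing :: "'a set set \<Rightarrow> ('a set \<Rightarrow> nat) \<Rightarrow> 'a \<Rightarrow> nat \<Rightarrow> bool" where
  "missing E c v \<alpha> \<longleftrightarrow> (\<forall>u. {v, u} \<in> E \<longrightarrow> c {v, u} \<noteq> \<alpha>)"

text \<open>The uncoloured edge at \<open>x\<close> can be moved along this relation: recolour the edge \<open>xu\<close>
  with the colour of \<open>xv\<close> and uncolour \<open>xv\<close>.\<close>

definition fan_step :: "'a set set \<Rightarrow> ('a set \<Rightarrow> nat) \<Rightarrow> 'a \<Rightarrow> 'a \<Rightarrow> 'a \<Rightarrow> bool" where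
  "fan_step E c x u v \<longleftrightarrow> {x, v} \<in> E \<and> missing E c u (c {x, v})"

lemma edge_coloring_less: "edge_coloring E k c \<Longrightarrow> e \<in> E \<Longrightarrow> c e < k"
  by (simp add: edge_coloring_def)

lemma edge_coloring_inj:
  "edge_coloring E k c \<Longrightarrow> {x, u} \<in> E \<Longrightarrow> {x, v} \<in> E \<Longrightarrow> c {x, u} = c {x, v} \<Longrightarrow> u = v"
  by (simp add: edge_coloring_def)

lemma edge_coloring_fun_upd:
  assumes c: "edge_coloring E k c" and "missing E c x \<alpha>" "missing E c y \<alpha>" "\<alpha> < k" "{x, y} \<notin> E"
  shows "edge_coloring (insert {x, y} E) k (c({x, y} := \<alpha>))"
proof -
  let ?c = "c({x, y} := \<alpha>)"
  have "u = v"
    if u: "{z, u} \<in> insert {x, y} E" and v: "{z, v} \<in> insert {x, y} E"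
      and eq: "?c {z, u} = ?c {z, v}" for z u v
  proof (cases "{z, u} = {x, y} \<or> {z, v} = {x, y}")
    case True
    then have "z = x \<or> z = y" by (auto simp: doubleton_eq_iff)
    then have "missing E c z \<alpha>" using assms(2,3) by blast
    then have "{z, u} = {x, y}" "{z, v} = {x, y}"
      using True u v eq by (auto simp: missing_def split: if_splits)
    then show ?thesis by (metis doubleton_eq_iff)
  next
    case False
    then show ?thesis using u v eq edge_coloring_inj[OF c] by simp
  qed
  moreover have "?c e < k" if "e \<in> insert {x, y} E" for e
    using that edge_coloring_less[OF c] assms(4) by auto
  ultimately show ?thesis unfolding edge_coloring_def by blast
qed

lemma fan_step_neq: "\<forall>e\<in>E. card e = 2 \<Longrightarrow> fan_step E c x u v \<Longrightarrow> v \<noteq> x"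
  by (auto simp: fan_step_def)

text \<open>Induction along the fan: \<open>{x, y}\<close> takes the colour of its successor
  \<open>{x, z}\<close>, which becomes the uncoloured edge. The colours seen at \<open>x\<close> do
  not change, so \<alpha> stays missing there and finally colours \<open>{x, w}\<close>.\<close>

lemma rotate_fan:
  assumes "rtrancl_path (fan_step E c x) y ys w" "distinct (y # ys)" "edge_coloring E k c"
    and "\<forall>e\<in>E. card e = 2" "x \<noteq> y" "{x, y} \<notin> E"
    and "missing E c x \<alpha>" "missing E c w \<alpha>" "\<alpha> < k"
  shows "\<exists>c'. edge_coloring (insert {x, y} E) k c'"
  using assms
proof (induction ys arbitrary: y E c)
  case Nil
  from Nil.prems(1) have "w = y" by (auto elim: rtrancl_path.cases)
  with Nil show ?case using edge_coloring_fun_upd by metis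
next
  case (Cons z zs)
  note c = Cons.prems(3)
  from Cons.prems(1) have st: "fan_step E c x y z" and pt: "rtrancl_path (fan_step E c x) z zs w"
    by (auto elim: rtrancl_path.cases)
  have xz: "x \<noteq> z" "{x, z} \<in> E" and mz: "missing E c y (c {x, z})"
    using st Cons.prems(4) by (auto simp: fan_step_def)
  have yz: "y \<noteq> z" using Cons.prems(2) by auto
  define E0 where "E0 = E - {{x, z}}"
  define E' where "E' = insert {x, y} E0"
  define c' where "c' = c({x, y} := c {x, z})"
  have "edge_coloring E0 k c" using c unfolding edge_coloring_def E0_def by auto
  moreover have "missing E0 c x (c {x, z})"
    using edge_coloring_inj[OF c] xz unfolding missing_def E0_def by blast
  moreover have "missing E0 c y (c {x, z})" using mz by (auto simp: missing_def E0_def)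
  ultimately have c': "edge_coloring E' k c'"
    unfolding E'_def c'_def using edge_coloring_less[OF c] xz Cons.prems(6)
    by (intro edge_coloring_fun_upd) (auto simp: E0_def)
  \<comment> \<open>Away from \<open>x\<close>, only \<open>y\<close> sees a new colour;
    \<open>z\<close> merely loses one.\<close>
  have keep: "missing E' c' u \<beta>" if "missing E c u \<beta>" "u \<noteq> y" "u \<noteq> x" for u \<beta>
    using that unfolding missing_def E'_def E0_def c'_def by (auto simp: doubleton_eq_iff)
  \<comment> \<open>The rest of the fan survives the shift. The vertex \<open>z\<close> may be its
    start but not a later target, since \<open>{x, z}\<close> has left the edge set.\<close>
  have pt': "rtrancl_path (fan_step E' c' x) u us w"
    if "rtrancl_path (fan_step E c x) u us w" "distinct (u # us)" "y \<notin> set (u # us)" "z \<notin> set us"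
      "u \<noteq> x" for u us
    using that
  proof (induction us arbitrary: u)
    case Nil
    then show ?case by (auto elim: rtrancl_path.cases intro: rtrancl_path.base)
  next
    case (Cons v vs)
    from Cons.prems(1) have s: "fan_step E c x u v" and p: "rtrancl_path (fan_step E c x) v vs w"
      by (auto elim: rtrancl_path.cases)
    have vx: "v \<noteq> x" using s fan_step_neq \<open>\<forall>e\<in>E. card e = 2\<close> by metis
    have "{x, v} \<in> E'" "c' {x, v} = c {x, v}"
      using s Cons.prems vx unfolding fan_step_def E'_def E0_def c'_def
      by (auto simp: doubleton_eq_iff)
    then have "fan_step E' c' x u v"
      using s keep Cons.prems by (auto simp: fan_step_def)
    moreover have "rtrancl_path (fan_step E' c' x) v vs w"
      using Cons p vx by auto
    ultimately show ?case by (rule rtrancl_path.step)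
  qed
  have w: "w \<in> set (z # zs)"
    using pt by (induction rule: rtrancl_path.induct) auto
  have wx: "w \<noteq> x"
    using pt xz(1) fan_step_neq[OF Cons.prems(4)]
    by (induction rule: rtrancl_path.induct) blast+
  have "\<exists>c''. edge_coloring (insert {x, z} E') k c''"
  proof (rule Cons.IH)
    show "rtrancl_path (fan_step E' c' x) z zs w" using pt' pt Cons.prems(2) xz by auto
    show "distinct (z # zs)" using Cons.prems(2) by simp
    show "edge_coloring E' k c'" by (rule c')
    show "\<forall>e\<in>E'. card e = 2" using Cons.prems(4,5) by (auto simp: E'_def E0_def)
    show "x \<noteq> z" by fact
    show "{x, z} \<notin> E'" using yz by (auto simp: E'_def E0_def doubleton_eq_iff)
    show "missing E' c' x \<alpha>" using Cons.prems(7) xz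
      by (auto simp: missing_def E'_def E0_def c'_def)
    show "missing E' c' w \<alpha>" using keep Cons.prems(2,8) w wx by auto
    show "\<alpha> < k" by fact
  qed
  moreover have "insert {x, z} E' = insert {x, y} E" using xz by (auto simp: E'_def E0_def)
  ultimately show ?case by simp
qed

section \<open>Kempe components and colour swaps\<close>

text \<open>Instead of following an alternating path, view its orbit as the orbit of \<open>x\<close> under two
  involutions. An orbit point \<open>(f \<circ> g)\<^sup>a x\<close> fixed by \<open>g\<close> gives \<open>(f \<circ> g)\<^bsup>2a+1\<^esup> x = x\<close>, so
  \<open>x\<close> has odd period and \<open>a\<close> is determined modulo that period.\<close>

lemma involutions_orbit:
  fixes f g :: "'a \<Rightarrow> 'a"
  assumes f: "\<And>u. f (f u) = u" and g: "\<And>u. g (g u) = u" and x: "f x = x"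
  shows "\<exists>C. x \<in> C \<and> f ` C \<subseteq> C \<and> g ` C \<subseteq> C \<and>
    (\<forall>y\<in>C. \<forall>z\<in>C. g y = y \<longrightarrow> g z = z \<longrightarrow> y = z)"
proof -
  define h where "h = f \<circ> g"
  define C where "C = (\<Union>i. {(h ^^ i) x, g ((h ^^ i) x)})"
  have inC: "(h ^^ i) x \<in> C" "g ((h ^^ i) x) \<in> C" for i
    unfolding C_def by blast+
  have C_cases: "\<exists>i. u = (h ^^ i) x \<or> u = g ((h ^^ i) x)" if "u \<in> C" for u
    using that unfolding C_def by simp
  have h: "h u = f (g u)" for u by (simp add: h_def)
  \<comment> \<open>This says that \<open>g\<close> conjugates \<open>h\<close> to its
    inverse.\<close>
  have reflect: "(h ^^ i) (g ((h ^^ i) u)) = g u" for i u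
  proof (induction i arbitrary: u)
    case (Suc i)
    have "(h ^^ Suc i) (g ((h ^^ Suc i) u)) = (h ^^ i) (h (g (h ((h ^^ i) u))))"
      by (simp add: funpow_swap1)
    also have "h (g (h ((h ^^ i) u))) = g ((h ^^ i) u)" by (simp add: h f g)
    finally show ?case using Suc by simp
  qed simp
  have hg: "h (g x) = x" using f g x by (simp add: h)
  have per: "(h ^^ (2 * a + 1)) x = x" if "g ((h ^^ a) x) = (h ^^ a) x" for a
  proof -
    have "(h ^^ (2 * a + 1)) x = h ((h ^^ a) ((h ^^ a) x))"
      by (simp add: mult_2 funpow_add)
    also have "\<dots> = h ((h ^^ a) (g ((h ^^ a) x)))" using that by simp
    also have "\<dots> = x" using reflect hg by simp
    finally show ?thesis .
  qed
  have uniq: "(h ^^ a) x = (h ^^ b) x"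
    if a: "g ((h ^^ a) x) = (h ^^ a) x" and b: "g ((h ^^ b) x) = (h ^^ b) x" and "a \<le> b" for a b
  proof -
    define e where "e = b - a"
    have be: "2 * b + 1 = 2 * e + (2 * a + 1)" using \<open>a \<le> b\<close> by (simp add: e_def)
    have "(h ^^ (2 * e)) x = (h ^^ (2 * e)) ((h ^^ (2 * a + 1)) x)" using per[OF a] by simp
    also have "\<dots> = x" using per[OF b] by (simp only: be funpow_add comp_apply)
    finally have p2: "(h ^^ (2 * e)) x = x" .
    have mult: "(h ^^ (m * j)) x = x" if "(h ^^ m) x = x" for m j
      using that by (induction j) (auto simp: funpow_add)
    \<comment> \<open>Modulo the even period \<open>2 * e\<close>, the multiple
      \<open>(2 * a + 1) * e\<close> of the odd period equals \<open>e\<close>, so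
      \<open>e = b - a\<close> is itself a period.\<close>
    have "x = (h ^^ ((2 * a + 1) * e)) x" using mult[OF per[OF a]] by simp
    also have "(2 * a + 1) * e = e + (2 * e) * a" by (simp add: algebra_simps)
    also have "(h ^^ (e + (2 * e) * a)) x = (h ^^ e) x" using mult[OF p2] by (simp add: funpow_add)
    finally have "(h ^^ a) ((h ^^ e) x) = (h ^^ a) x" by simp
    moreover have "b = a + e" using \<open>a \<le> b\<close> by (simp add: e_def)
    ultimately show ?thesis by (simp add: funpow_add)
  qed
  have fh: "f ((h ^^ i) x) \<in> C" for i
  proof (cases i)
    case 0
    then show ?thesis using x inC(1)[of 0] by simp
  next
    case (Suc j)
    then have "f ((h ^^ i) x) = g ((h ^^ j) x)" by (simp add: h f)
    then show ?thesis using inC(2) by simp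
  qed
  have fg: "f (g ((h ^^ i) x)) \<in> C" for i
    using inC(1)[of "Suc i"] by (simp add: h)
  have "f u \<in> C" if "u \<in> C" for u
    using C_cases[OF that] fh fg by metis
  moreover have "g u \<in> C" if "u \<in> C" for u
    using C_cases[OF that] inC g by metis
  moreover have "x \<in> C" using inC(1)[of 0] by simp
  moreover have "y = z" if yzC: "y \<in> C" "z \<in> C" and yz: "g y = y" "g z = z" for y z
  proof -
    have "\<exists>i. u = (h ^^ i) x" if "u \<in> C" "g u = u" for u
      using C_cases[OF that(1)] that(2) g by metis
    then obtain a b where "y = (h ^^ a) x" "z = (h ^^ b) x" using yzC yz by meson
    then show ?thesis using yz uniq[of a b] uniq[of b a] by (metis nat_le_linear)
  qed
  ultimately show ?thesis by (intro exI[of _ C] conjI image_subsetI ballI impI)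
qed

text \<open>The involution exchanging the ends of every edge of colour \<alpha>; the default
  \<open>v\<close> makes vertices that miss \<alpha> fixed points.\<close>

definition partner :: "'a set set \<Rightarrow> ('a set \<Rightarrow> nat) \<Rightarrow> nat \<Rightarrow> 'a \<Rightarrow> 'a" where
  "partner E c \<alpha> v = (if missing E c v \<alpha> then v else THE u. {v, u} \<in> E \<and> c {v, u} = \<alpha>)"

lemma partner_eqI:
  assumes "edge_coloring E k c" "{v, u} \<in> E" "c {v, u} = \<alpha>"
  shows "partner E c \<alpha> v = u"
proof -
  have "(THE u. {v, u} \<in> E \<and> c {v, u} = \<alpha>) = u"
    using assms edge_coloring_inj[OF assms(1)] by (intro the_equality) auto
  then show ?thesis using assms by (auto simp: partner_def missing_def)
qed

lemma partner_partner:
  assumes "edge_coloring E k c"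
  shows "partner E c \<alpha> (partner E c \<alpha> v) = v"
proof (cases "missing E c v \<alpha>")
  case True
  then show ?thesis by (simp add: partner_def)
next
  case False
  then obtain u where u: "{v, u} \<in> E" "c {v, u} = \<alpha>" by (auto simp: missing_def)
  then have "{u, v} \<in> E" "c {u, v} = \<alpha>" by (auto simp: insert_commute)
  with u show ?thesis using partner_eqI[OF assms] by metis
qed

text \<open>Connectedness is not demanded: swapping two colours on any closed set preserves
  properness.\<close>

definition kempe_closed :: "'a set set \<Rightarrow> ('a set \<Rightarrow> nat) \<Rightarrow> nat \<Rightarrow> nat \<Rightarrow> 'a set \<Rightarrow> bool" where
  "kempe_closed E c \<alpha> \<beta> C \<longleftrightarrow>
     (\<forall>u v. {u, v} \<in> E \<longrightarrow> c {u, v} \<in> {\<alpha>, \<beta>} \<longrightarrow> u \<in> C \<longrightarrow> v \<in> C)"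

text \<open>Classically, the alternating component of \<open>x\<close> is a path starting at
  \<open>x\<close>, so at most one of its vertices can miss \<beta>. Here \<open>x\<close> is a
  fixed point of the \<alpha>-partner map, and \<open>involutions_orbit\<close> applies to the two
  partner maps.\<close>

lemma kempe_component:
  assumes c: "edge_coloring E k c" and x: "missing E c x \<alpha>"
  shows "\<exists>C. x \<in> C \<and> kempe_closed E c \<alpha> \<beta> C \<and>
    (\<forall>y\<in>C. \<forall>z\<in>C. missing E c y \<beta> \<longrightarrow> missing E c z \<beta> \<longrightarrow> y = z)"
proof -
  have "partner E c \<alpha> x = x" using x by (simp add: partner_def)
  then have "\<exists>C. x \<in> C \<and> partner E c \<alpha> ` C \<subseteq> C \<and> partner E c \<beta> ` C \<subseteq> C \<and>
    (\<forall>y\<in>C. \<forall>z\<in>C. partner E c \<beta> y = y \<longrightarrow> partner E c \<beta> z = z \<longrightarrow> y = z)"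
    by (intro involutions_orbit partner_partner[OF c])
  then obtain C where C: "x \<in> C" "partner E c \<alpha> ` C \<subseteq> C" "partner E c \<beta> ` C \<subseteq> C"
    "\<forall>y\<in>C. \<forall>z\<in>C. partner E c \<beta> y = y \<longrightarrow> partner E c \<beta> z = z \<longrightarrow> y = z"
    by (elim exE conjE)
  have "v \<in> C" if "{u, v} \<in> E" "c {u, v} \<in> {\<alpha>, \<beta>}" "u \<in> C" for u v
  proof -
    have "v = partner E c \<alpha> u \<or> v = partner E c \<beta> u"
      using that partner_eqI[OF c that(1)] by auto
    with C that(3) show ?thesis by blast
  qed
  moreover have "y = z" if "y \<in> C" "z \<in> C" "missing E c y \<beta>" "missing E c z \<beta>" for y z
    using that C(4) by (auto simp: partner_def)
  ultimately show ?thesis using C(1) unfolding kempe_closed_def by blast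
qed

definition kempe_swap :: "'a set \<Rightarrow> nat \<Rightarrow> nat \<Rightarrow> ('a set \<Rightarrow> nat) \<Rightarrow> 'a set \<Rightarrow> nat" where
  "kempe_swap C \<alpha> \<beta> c e = (if e \<inter> C = {} then c e else transpose \<alpha> \<beta> (c e))"

text \<open>An edge coloured \<alpha> or \<beta> has both ends in \<open>C\<close> or neither, and
  the transposition fixes every other colour, so either end may decide.\<close>

lemma kempe_swap_edge:
  assumes "kempe_closed E c \<alpha> \<beta> C" "{u, v} \<in> E"
  shows "kempe_swap C \<alpha> \<beta> c {u, v} = (if u \<in> C then transpose \<alpha> \<beta> (c {u, v}) else c {u, v})"
proof (cases "c {u, v} \<in> {\<alpha>, \<beta>}")
  case True
  then have "u \<in> C \<longleftrightarrow> v \<in> C" using assms unfolding kempe_closed_def by (metis insert_commute)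
  then show ?thesis by (auto simp: kempe_swap_def)
qed (auto simp: kempe_swap_def transpose_def)

lemma missing_kempe_swap:
  assumes "kempe_closed E c \<alpha> \<beta> C"
  shows "missing E (kempe_swap C \<alpha> \<beta> c) v \<gamma> \<longleftrightarrow>
    missing E c v (if v \<in> C then transpose \<alpha> \<beta> \<gamma> else \<gamma>)"
  unfolding missing_def using kempe_swap_edge[OF assms] by (metis transpose_involutory)

lemma edge_coloring_kempe_swap:
  assumes "kempe_closed E c \<alpha> \<beta> C"
    and c: "edge_coloring E k c" and "\<alpha> < k" "\<beta> < k"
  shows "edge_coloring E k (kempe_swap C \<alpha> \<beta> c)"
proof -
  have "kempe_swap C \<alpha> \<beta> c e < k" if "e \<in> E" for e
    using edge_coloring_less[OF c that] assms(3,4) by (auto simp: kempe_swap_def transpose_def)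
  moreover have "u = v"
    if "{x, u} \<in> E" "{x, v} \<in> E" "kempe_swap C \<alpha> \<beta> c {x, u} = kempe_swap C \<alpha> \<beta> c {x, v}" for x u v
    using that kempe_swap_edge[OF assms(1)] edge_coloring_inj[OF c that(1,2)]
    by (metis transpose_involutory)
  ultimately show ?thesis unfolding edge_coloring_def by blast
qed

section \<open>Extending a colouring by one edge\<close>

lemma exists_missing:
  assumes "finite E" "card {e \<in> E. v \<in> e} < k"
  shows "\<exists>\<alpha><k. missing E c v \<alpha>"
proof -
  have "card (c ` {e \<in> E. v \<in> e}) < card {..<k}"
    using assms card_image_le[of "{e \<in> E. v \<in> e}" c] by simp
  then have "\<not> {..<k} \<subseteq> c ` {e \<in> E. v \<in> e}"
    using assms(1) card_mono[of "c ` {e \<in> E. v \<in> e}" "{..<k}"] by auto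
  then obtain \<alpha> where "\<alpha> < k" and \<alpha>: "\<alpha> \<notin> c ` {e \<in> E. v \<in> e}"
    by (meson lessThan_iff subsetI)
  moreover have "missing E c v \<alpha>" using \<alpha> by (force simp: missing_def)
  ultimately show ?thesis by blast
qed

text \<open>If no extension exists, \<open>x\<close> shares no missing colour with any vertex
  reachable by fan steps. Two reachable vertices then miss a common colour \<beta>, and one of them
  lies outside the \<alpha>-\<beta> component of \<open>x\<close>. Swapping on that component frees
  \<beta> at \<open>x\<close> but leaves it missing at a reachable vertex outside.\<close>

lemma edge_coloring_insert:
  assumes fin: "finite E" and c: "edge_coloring E k c" and E2: "\<forall>e\<in>E. card e = 2"
    and xy: "x \<noteq> y" "{x, y} \<notin> E" and deg: "\<And>v. card {e \<in> E. v \<in> e} < k"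
  shows "\<exists>c'. edge_coloring (insert {x, y} E) k c'"
proof (rule ccontr)
  assume no: "\<nexists>c'. edge_coloring (insert {x, y} E) k c'"
  \<comment> \<open>Stated for an arbitrary colouring because it is applied both before and after
    the swap.\<close>
  have rot: False
    if c: "edge_coloring E k c" and fan: "(fan_step E c x)\<^sup>*\<^sup>* y w"
      and miss: "missing E c x \<alpha>" "missing E c w \<alpha>" "\<alpha> < k"
    for c w \<alpha>
  proof -
    obtain ys where "rtrancl_path (fan_step E c x) y ys w"
      using fan rtranclp_eq_rtrancl_path by metis
    then obtain ys where "rtrancl_path (fan_step E c x) y ys w" "distinct (y # ys)"
      using rtrancl_path_distinct by metis
    then show False using rotate_fan[OF _ _ c E2 xy miss] no by blast
  qed
  obtain \<alpha> where \<alpha>: "\<alpha> < k" "missing E c x \<alpha>" using exists_missing[OF fin deg] by blast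
  obtain m where m: "\<And>v. m v < k" "\<And>v. missing E c v (m v)"
    using exists_missing[OF fin deg] by metis
  define Y where "Y = {u. (fan_step E c x)\<^sup>*\<^sup>* y u}"
  have "\<exists>v. {x, v} \<in> E \<and> c {x, v} = m u" if "u \<in> Y" for u
    using rot[OF c _ _ m(2)[of u] m(1)] that unfolding Y_def missing_def by blast
  then obtain nx where nx: "\<And>u. u \<in> Y \<Longrightarrow> {x, nx u} \<in> E \<and> c {x, nx u} = m u" by metis
  have nxY: "nx ` Y \<subseteq> Y - {y}"
  proof
    fix v assume "v \<in> nx ` Y"
    then obtain u where u: "u \<in> Y" "v = nx u" by blast
    then have "fan_step E c x u v" using nx m(2) by (simp add: fan_step_def)
    with u have "v \<in> Y" unfolding Y_def by auto
    with u nx xy show "v \<in> Y - {y}" by auto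
  qed
  have "finite (\<Union>E)" using fin E2 by (metis card.infinite finite_Union zero_neq_numeral)
  moreover have "Y \<subseteq> insert y (\<Union>E)"
  proof
    fix u assume "u \<in> Y"
    then have "(fan_step E c x)\<^sup>*\<^sup>* y u" by (simp add: Y_def)
    then show "u \<in> insert y (\<Union>E)" by (cases) (auto simp: fan_step_def)
  qed
  ultimately have finY: "finite Y" by (meson finite.insertI finite_subset)
  have "y \<in> Y" by (simp add: Y_def)
  \<comment> \<open>Since \<open>nx\<close> maps the finite set \<open>Y\<close> into itself and
    omits \<open>y\<close>, it is not injective. A collision \<open>nx u1 = nx u2\<close> means that
    \<open>m u1\<close> and \<open>m u2\<close> are the colour of one edge at
    \<open>x\<close>.\<close>
  then have "card (nx ` Y) < card Y"
    using nxY finY by (metis card_Diff1_less card_mono finite_Diff order.strict_trans1)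
  then have "\<not> inj_on nx Y" using pigeonhole by blast
  then obtain u1 u2 where u: "u1 \<in> Y" "u2 \<in> Y" "u1 \<noteq> u2" "nx u1 = nx u2"
    by (auto simp: inj_on_def)
  define \<beta> where "\<beta> = m u1"
  have \<beta>: "m u2 = \<beta>" "\<beta> < k" using u nx m(1) by (metis \<beta>_def)+
  obtain C where C: "x \<in> C"
    and closed: "kempe_closed E c \<alpha> \<beta> C"
    and uniq: "\<And>y z. y \<in> C \<Longrightarrow> z \<in> C \<Longrightarrow> missing E c y \<beta> \<Longrightarrow> missing E c z \<beta> \<Longrightarrow> y = z"
    using kempe_component[OF c \<alpha>(2), of \<beta>] by blast
  obtain u where u: "u \<in> Y" "u \<notin> C" "missing E c u \<beta>"
    using uniq u m(2) \<beta> \<beta>_def by metis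
  define c' where "c' = kempe_swap C \<alpha> \<beta> c"
  have c': "edge_coloring E k c'"
    unfolding c'_def using edge_coloring_kempe_swap closed c \<alpha>(1) \<beta>(2) by metis
  have miss: "missing E c' v \<gamma> \<longleftrightarrow> missing E c v (if v \<in> C then transpose \<alpha> \<beta> \<gamma> else \<gamma>)" for v \<gamma>
    unfolding c'_def by (rule missing_kempe_swap[OF closed])
  have edge: "c' {x, v} = transpose \<alpha> \<beta> (c {x, v})" if "{x, v} \<in> E" for v
    using C by (simp add: c'_def kempe_swap_def)
  \<comment> \<open>The swap breaks a fan step \<open>w \<rightarrow> v\<close> only if \<open>w\<close> lies outside \<open>C\<close> and misses \<open>\<beta>\<close>;
    in that case the fan may stop at \<open>w\<close>.\<close>
  have "(fan_step E c' x)\<^sup>*\<^sup>* y v \<or> (\<exists>w. (fan_step E c' x)\<^sup>*\<^sup>* y w \<and> w \<notin> C \<and> missing E c w \<beta>)"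
    if "(fan_step E c x)\<^sup>*\<^sup>* y v" for v
    using that
  proof (induction rule: rtranclp_induct)
    case (step w v)
    have w: "{x, v} \<in> E" "missing E c w (c {x, v})" using step(2) by (auto simp: fan_step_def)
    have "c {x, v} \<noteq> \<alpha>" using w(1) \<alpha>(2) by (auto simp: missing_def)
    then have "fan_step E c' x w v \<or> (w \<notin> C \<and> missing E c w \<beta>)"
      using w miss edge unfolding fan_step_def by (cases "c {x, v} = \<beta>") auto
    with step(3) show ?case by (meson rtranclp.rtrancl_into_rtrancl)
  qed simp
  with u obtain w where w: "(fan_step E c' x)\<^sup>*\<^sup>* y w" "w \<notin> C" "missing E c w \<beta>"
    unfolding Y_def by blast
  \<comment> \<open>The swap turns the colour \<alpha> missing at \<open>x\<close> into \<beta>, and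
    does not affect \<open>w\<close>, which lies outside \<open>C\<close>.\<close>
  show False
  proof (rule rot[OF c' w(1) _ _ \<beta>(2)])
    show "missing E c' x \<beta>" using miss C \<alpha>(2) by simp
    show "missing E c' w \<beta>" using miss w by simp
  qed
qed

text \<open>The degree bound is strict: maximum degree \<open>d\<close> allows
  \<open>k = d + 1\<close>.\<close>

theorem vizing:
  assumes "finite E" "\<forall>e\<in>E. card e = 2" "\<And>v. card {e \<in> E. v \<in> e} < k"
  shows "\<exists>c. edge_coloring E k c"
  using assms
proof (induction E rule: finite_induct)
  case empty
  show ?case by (simp add: edge_coloring_def)
next
  case (insert e E)
  obtain x y where e: "e = {x, y}" "x \<noteq> y" using insert.prems(1) by (meson card_2_iff insertI1)
  have deg: "card {e \<in> E. v \<in> e} < k" for v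
  proof -
    have "card {e \<in> E. v \<in> e} \<le> card {e' \<in> insert e E. v \<in> e'}"
      using insert.hyps(1) by (intro card_mono) auto
    then show ?thesis using insert.prems(2) by (meson le_less_trans)
  qed
  moreover obtain c where "edge_coloring E k c" using insert.IH insert.prems(1) deg by auto
  ultimately show ?case using edge_coloring_insert[of E k c x y] insert e by auto
qed

section \<open>Unitary Cayley graphs\<close>

text \<open>By symmetry an edge can be written with any of its ends first, so conflicts between
  edges need checking only for pairs \<open>{u, v}\<close>, \<open>{u, w}\<close>.\<close>

lemma total_coloringI:
  assumes sym: "\<And>u v. (u, v) \<in> parcs G \<Longrightarrow> (v, u) \<in> parcs G"
    and vertex: "\<And>u v. (u, v) \<in> parcs G \<Longrightarrow> cV u \<noteq> cV v"
    and edge: "\<And>u v w. (u, v) \<in> parcs G \<Longrightarrow> (u, w) \<in> parcs G \<Longrightarrow> cE {u, v} = cE {u, w} \<Longrightarrow> v = w"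
    and inc: "\<And>u v. (u, v) \<in> parcs G \<Longrightarrow> cE {u, v} \<noteq> cV u"
  shows "total_coloring G cV cE"
proof -
  have incident: "\<exists>v. e = {u, v} \<and> (u, v) \<in> parcs G" if "e \<in> undirected_edges G" "u \<in> e" for e u
    using that sym unfolding undirected_edges_def by (auto simp: insert_commute)
  have "cE e \<noteq> cE f"
    if e: "e \<in> undirected_edges G" and f: "f \<in> undirected_edges G" and ne: "e \<noteq> f"
      and "e \<inter> f \<noteq> {}" for e f
  proof -
    obtain u where "u \<in> e" "u \<in> f" using \<open>e \<inter> f \<noteq> {}\<close> by blast
    then show ?thesis using incident[OF e] incident[OF f] edge ne by metis
  qed
  moreover have "cE e \<noteq> cV v" if "e \<in> undirected_edges G" "v \<in> e" for e v
    using incident[OF that] inc by metis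
  ultimately show ?thesis using vertex unfolding total_coloring_def by blast
qed

lemma unitary_cayley_graph_arc_iff:
  "(a, b) \<in> parcs (unitary_cayley_graph n) \<longleftrightarrow>
     a < n \<and> b < n \<and> gcd (int a - int b) (int n) = 1"
  by (simp add: unitary_cayley_graph_def)

lemma unitary_cayley_graph_sym:
  "(a, b) \<in> parcs (unitary_cayley_graph n) \<Longrightarrow> (b, a) \<in> parcs (unitary_cayley_graph n)"
  using gcd_neg1_int[of "int a - int b" "int n"] by (simp add: unitary_cayley_graph_arc_iff)

text \<open>Makes residues modulo a prime factor of \<open>n\<close> a proper vertex colouring;
  applied to 2 for even \<open>n\<close> and to the least prime factor for odd
  \<open>n\<close>.\<close>

lemma not_arc_if_dvd:
  assumes "prime p" "p dvd n" "int p dvd int a - int b"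
  shows "(a, b) \<notin> parcs (unitary_cayley_graph n)"
proof
  assume "(a, b) \<in> parcs (unitary_cayley_graph n)"
  then have "gcd (int a - int b) (int n) = 1" by (simp add: unitary_cayley_graph_arc_iff)
  moreover have "int p dvd gcd (int a - int b) (int n)" using assms by simp
  ultimately show False using assms(1) by (simp add: prime_nat_iff)
qed

lemma mod_eq_iff_dvd_int: "a mod p = b mod p \<longleftrightarrow> int p dvd int a - int b" for a b p :: nat
  by (metis mod_eq_dvd_iff of_nat_eq_iff zmod_int)

lemma degree_le_max_degree:
  assumes "v < n"
  shows "card {u. (v, u) \<in> parcs (unitary_cayley_graph n)} \<le> max_degree (unitary_cayley_graph n)"
proof -
  let ?G = "unitary_cayley_graph n"
  have "out_arcs (with_proj ?G) v = Pair v ` {u. (v, u) \<in> parcs ?G}"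
    by (auto simp: out_arcs_def)
  then have "out_degree (with_proj ?G) v = card {u. (v, u) \<in> parcs ?G}"
    by (simp add: out_degree_def card_image inj_on_def)
  moreover have "out_degree (with_proj ?G) v \<le> max_degree ?G"
    unfolding max_degree_def using assms by (intro Max_ge) (auto simp: unitary_cayley_graph_def)
  ultimately show ?thesis by simp
qed

section \<open>Even \<open>n\<close>: the bipartite case\<close>

lemma total_colorable_even:
  assumes "even n" "n > 1"
  shows "total_colorable (unitary_cayley_graph n) (max_degree (unitary_cayley_graph n) + 2)"
proof -
  let ?G = "unitary_cayley_graph n"
  \<comment> \<open>The units modulo \<open>n\<close>, taken as the neighbourhood of 0 so that their
    number is at most the maximum degree.\<close>
  define U where "U = {u. (0, u) \<in> parcs ?G}"
  have U: "u \<in> U \<longleftrightarrow> u < n \<and> gcd (int u) (int n) = 1" for u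
    using assms(2) by (simp add: U_def unitary_cayley_graph_arc_iff)
  have "finite U" by (rule finite_subset[of _ "{..<n}"]) (auto simp: U)
  then obtain h where h: "bij_betw h U {0..<card U}" using ex_bij_betw_finite_nat by blast
  have cardU: "card U \<le> max_degree ?G"
    unfolding U_def using degree_le_max_degree assms(2) by simp
  \<comment> \<open>Every edge has exactly one odd end, so the sum of the signed ends is the odd end
    minus the even one, without choosing an orientation.\<close>
  define s :: "nat \<Rightarrow> int" where "s v = (if odd v then int v else - int v)" for v
  define d where "d e = nat (sum s e mod int n)" for e
  have parity: "odd u \<longleftrightarrow> even v" if "(u, v) \<in> parcs ?G" for u v
    using not_arc_if_dvd[of 2 n u v] assms(1) that by auto
  have d: "int (d {u, v}) = (if odd u then int u - int v else int v - int u) mod int n"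
    and dU: "d {u, v} \<in> U" if uv: "(u, v) \<in> parcs ?G" for u v
  proof -
    have "u \<noteq> v" using parity[OF uv] by auto
    then have "sum s {u, v} = (if odd u then int u - int v else int v - int u)"
      using parity[OF uv] by (auto simp: s_def)
    then show *: "int (d {u, v}) = (if odd u then int u - int v else int v - int u) mod int n"
      using assms(2) by (simp add: d_def)
    have "gcd (int (d {u, v})) (int n) = 1"
      unfolding * using uv unitary_cayley_graph_sym[OF uv]
      by (simp add: unitary_cayley_graph_arc_iff gcd.commute[of _ "int n"] flip: gcd_red_int)
    moreover have "int (d {u, v}) < int n" unfolding * using assms(2) by simp
    ultimately show "d {u, v} \<in> U" using U by simp
  qed
  \<comment> \<open>Edges use the colours below \<open>card U\<close>, leaving \<open>card U\<close>
    and \<open>card U + 1\<close> for the two parity classes.\<close>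
  define cV where "cV v = card U + v mod 2" for v
  define cE where "cE e = h (d e)" for e
  have cE_less: "cE {u, v} < card U" if "(u, v) \<in> parcs ?G" for u v
    using dU[OF that] h unfolding cE_def bij_betw_def by auto
  have "total_coloring ?G cV cE"
  proof (rule total_coloringI)
    show "(v, u) \<in> parcs ?G" if "(u, v) \<in> parcs ?G" for u v
      using that by (rule unitary_cayley_graph_sym)
    show "cV u \<noteq> cV v" if "(u, v) \<in> parcs ?G" for u v
      using parity[OF that] by (auto simp: cV_def mod2_eq_if)
    show "cE {u, v} \<noteq> cV u" if "(u, v) \<in> parcs ?G" for u v
      using cE_less[OF that] by (simp add: cV_def)
    show "v = w" if uv: "(u, v) \<in> parcs ?G" and uw: "(u, w) \<in> parcs ?G"
      and eq: "cE {u, v} = cE {u, w}" for u v w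
    proof -
      have "d {u, v} = d {u, w}"
        using eq dU[OF uv] dU[OF uw] h unfolding cE_def bij_betw_def inj_on_def by blast
      then have "int n dvd int v - int w"
        using d[OF uv] d[OF uw] by (auto simp: mod_eq_dvd_iff dvd_diff_commute split: if_splits)
      then have "v mod n = w mod n" by (simp add: mod_eq_iff_dvd_int)
      then show ?thesis using uv uw by (simp add: unitary_cayley_graph_arc_iff)
    qed
  qed
  moreover have "cV ` pverts ?G \<subseteq> {..<max_degree ?G + 2}"
    using cardU by (auto simp: cV_def intro: add_le_less_mono)
  moreover have "cE ` undirected_edges ?G \<subseteq> {..<max_degree ?G + 2}"
    using cardU cE_less unfolding undirected_edges_def by fastforce
  ultimately show ?thesis unfolding total_colorable_def by blast
qed

section \<open>Odd \<open>n\<close>: cliques of consecutive vertices and the remaining edges\<close>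

lemma total_colorable_odd:
  assumes "odd n" "n > 1"
  shows "total_colorable (unitary_cayley_graph n) (max_degree (unitary_cayley_graph n) + 2)"
proof -
  let ?G = "unitary_cayley_graph n"
  let ?D = "max_degree ?G"
  define p where "p = (LEAST p. prime p \<and> p dvd n)"
  have "\<exists>p. prime p \<and> p dvd n" using prime_factor_nat assms(2) by auto
  then have p: "prime p" "p dvd n" and least: "\<And>q. prime q \<Longrightarrow> q dvd n \<Longrightarrow> p \<le> q"
    unfolding p_def by (metis (mono_tags, lifting) LeastI_ex, metis (mono_tags, lifting) LeastI_ex)
      (auto intro: Least_le)
  have "p > 1" using p(1) prime_gt_1_nat by blast
  have "odd p" using p(2) assms(1) by (meson dvd_trans)
  obtain m where m: "n = p * m" using p(2) by blast
  \<comment> \<open>As \<open>p\<close> divides \<open>n\<close>, the last block is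
    complete.\<close>
  have block_less: "u < n" if "u div p = v div p" "v < n" for u v
    using that \<open>p > 1\<close> unfolding m by (metis div_less_iff_less_mult mult.commute zero_less_one
        less_trans)
  have clique: "(u, v) \<in> parcs ?G" if block: "u div p = v div p" and "u \<noteq> v" "u < n" "v < n" for u v
  proof -
    define d where "d = nat \<bar>int u - int v\<bar>"
    have "int u = int p * int (v div p) + int (u mod p)" "int v = int p * int (v div p) + int (v mod p)"
      using block by (metis mult_div_mod_eq of_nat_add of_nat_mult)+
    then have "\<bar>int u - int v\<bar> < int p"
      using \<open>p > 1\<close> mod_less_divisor[of p u] mod_less_divisor[of p v] by linarith
    then have d: "0 < d" "d < p" using \<open>u \<noteq> v\<close> by (auto simp: d_def)
    have "coprime d n"
    proof (rule ccontr)
      assume "\<not> coprime d n"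
      then obtain q where "prime q" "q dvd gcd d n"
        using prime_factor_nat[of "gcd d n"] by (auto simp: coprime_iff_gcd_eq_1)
      then have "p \<le> q" "q \<le> d" using least d(1) by (auto intro: dvd_imp_le)
      then show False using d(2) by simp
    qed
    then have "gcd (int d) (int n) = 1" by (simp flip: coprime_iff_gcd_eq_1)
    then show ?thesis using that by (simp add: d_def unitary_cayley_graph_arc_iff)
  qed
  define R where "R = {{u, v} | u v. (u, v) \<in> parcs ?G \<and> u div p \<noteq> v div p}"
  have R_iff: "{u, v} \<in> R \<longleftrightarrow> u div p \<noteq> v div p" if "(u, v) \<in> parcs ?G" for u v
    using that unfolding R_def by (auto simp: doubleton_eq_iff)
  have fin: "finite R"
    by (rule finite_subset[of _ "Pow {..<n}"])
      (auto simp: R_def unitary_cayley_graph_arc_iff)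
  have R2: "\<forall>e\<in>R. card e = 2" by (auto simp: R_def card_2_iff)
  \<comment> \<open>All \<open>p - 1\<close> other vertices of the block of \<open>v\<close> are
    neighbours of \<open>v\<close>, and edges to them do not belong to \<open>R\<close>.\<close>
  have R_deg: "card {e \<in> R. v \<in> e} + (p - 1) \<le> ?D" if "v < n" for v
  proof -
    define N where "N = {u. (v, u) \<in> parcs ?G}"
    define K where "K = {u. u div p = v div p} - {v}"
    have "finite N"
      by (rule finite_subset[of _ "{..<n}"]) (auto simp: N_def unitary_cayley_graph_arc_iff)
    have "u div p = q \<longleftrightarrow> u \<in> {q * p..<q * p + p}" for u q
      using \<open>p > 1\<close> div_times_less_eq_dividend[of u p] dividend_less_div_times[of p u]
        div_nat_eqI[of p q u]
      by (auto simp: algebra_simps)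
    then have "{u. u div p = v div p} = {v div p * p..<v div p * p + p}" by blast
    then have "card {u. u div p = v div p} = p" by simp
    then have "card K = p - 1" unfolding K_def by (subst card_Diff_singleton) auto
    have "K \<subseteq> N" using clique[of v] block_less[OF _ that] that by (auto simp: K_def N_def)
    have "{e \<in> R. v \<in> e} \<subseteq> (\<lambda>u. {v, u}) ` (N - K)"
      using unitary_cayley_graph_sym by (fastforce simp: R_def N_def K_def)
    then have "card {e \<in> R. v \<in> e} \<le> card (N - K)"
      using \<open>finite N\<close> by (meson card_image_le card_mono finite_Diff finite_imageI le_trans)
    also have "\<dots> = card N - (p - 1)"
      using \<open>K \<subseteq> N\<close> \<open>finite N\<close> \<open>card K = p - 1\<close> by (metis card_Diff_subset finite_subset)
    finally show ?thesis
      using card_mono[OF \<open>finite N\<close> \<open>K \<subseteq> N\<close>] \<open>card K = p - 1\<close> degree_le_max_degree[OF that]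
      unfolding N_def by linarith
  qed
  have pD: "p - 1 \<le> ?D" using R_deg[of 0] assms(2) by simp
  have "card {e \<in> R. v \<in> e} < ?D - (p - 1) + 1" for v
  proof (cases "v < n")
    case True
    then show ?thesis using R_deg[of v] by linarith
  next
    case False
    then have "{e \<in> R. v \<in> e} = {}" by (auto simp: R_def unitary_cayley_graph_arc_iff)
    then show ?thesis by (simp only: card.empty add_gr_0 zero_less_one simp_thms)
  qed
  from vizing[OF fin R2 this] obtain c where c: "edge_coloring R (?D - (p - 1) + 1) c" ..
  \<comment> \<open>The vertex colour is the value of \<open>(u + v) mod p\<close> at
    \<open>u = v\<close>, so an edge within a block agrees with its end \<open>u\<close> only if
    \<open>v\<close> is congruent to \<open>u\<close>. Doubling is injective modulo \<open>p\<close>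
    because \<open>p\<close> is odd.\<close>
  define cV where "cV v = 2 * v mod p" for v
  \<comment> \<open>Colours from \<open>p\<close> on are reserved for \<open>R\<close>, so its edges
    clash neither with vertices nor with edges inside blocks. In total
    \<open>p + (?D - (p - 1) + 1) = ?D + 2\<close> colours are available.\<close>
  define cE where "cE e = (if e \<in> R then p + c e else \<Sum>e mod p)" for e
  have neq: "u \<noteq> v" if "(u, v) \<in> parcs ?G" for u v
    using that not_arc_if_dvd[OF p, of u u] by auto
  have in_block: "cE {u, v} = (u + v) mod p" if "(u, v) \<in> parcs ?G" "u div p = v div p" for u v
    using that R_iff neq by (simp add: cE_def)
  have "total_coloring ?G cV cE"
  proof (rule total_coloringI)
    show "(v, u) \<in> parcs ?G" if "(u, v) \<in> parcs ?G" for u v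
      using that by (rule unitary_cayley_graph_sym)
    show "cV u \<noteq> cV v" if uv: "(u, v) \<in> parcs ?G" for u v
    proof
      assume "cV u = cV v"
      then have "int p dvd 2 * (int u - int v)"
        by (simp add: cV_def mod_eq_iff_dvd_int algebra_simps)
      moreover have "\<not> int p dvd 2"
        using \<open>odd p\<close> \<open>p > 1\<close> zdvd_imp_le[of "int p" 2] by (cases "p = 2") auto
      ultimately have "int p dvd int u - int v"
        using p(1) by (meson prime_dvd_multD prime_nat_int_transfer)
      then show False using not_arc_if_dvd[OF p] uv by blast
    qed
    show "cE {u, v} \<noteq> cV u" if uv: "(u, v) \<in> parcs ?G" for u v
    proof (cases "u div p = v div p")
      case True
      show ?thesis
      proof
        assume "cE {u, v} = cV u"
        then have "int p dvd int v - int u"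
          using in_block[OF uv True] by (simp add: cV_def mod_eq_iff_dvd_int)
        then show False using not_arc_if_dvd[OF p] unitary_cayley_graph_sym[OF uv] by blast
      qed
    next
      case False
      then have "p \<le> cE {u, v}" using R_iff[OF uv] by (simp add: cE_def)
      moreover have "cV u < p" using \<open>p > 1\<close> by (simp add: cV_def)
      ultimately show ?thesis by simp
    qed
    show "v = w" if uv: "(u, v) \<in> parcs ?G" and uw: "(u, w) \<in> parcs ?G"
      and eq: "cE {u, v} = cE {u, w}" for u v w
    proof -
      have "cE e < p \<longleftrightarrow> e \<notin> R" for e using \<open>p > 1\<close> by (simp add: cE_def)
      then have same: "{u, v} \<in> R \<longleftrightarrow> {u, w} \<in> R"
        using eq by metis
      show ?thesis
      proof (cases "{u, v} \<in> R")
        case True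
        then show ?thesis using same eq edge_coloring_inj[OF c] by (simp add: cE_def)
      next
        case False
        then have "u div p = v div p" "u div p = w div p" using same R_iff uv uw by auto
        moreover from this have "v mod p = w mod p"
          using eq in_block uv uw by (simp add: mod_eq_iff_dvd_int)
        ultimately show ?thesis by (metis mult_div_mod_eq)
      qed
    qed
  qed
  moreover have "cV ` pverts ?G \<subseteq> {..<?D + 2}"
  proof -
    have "cV v < ?D + 2" for v
      using mod_less_divisor[of p "2 * v"] \<open>p > 1\<close> pD unfolding cV_def by linarith
    then show ?thesis by blast
  qed
  moreover have "cE ` undirected_edges ?G \<subseteq> {..<?D + 2}"
  proof -
    have "cE e < ?D + 2" for e
    proof (cases "e \<in> R")
      case True
      then show ?thesis using edge_coloring_less[OF c True] pD \<open>p > 1\<close> by (simp add: cE_def)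
    next
      case False
      then have "cE e < p" using \<open>p > 1\<close> by (simp add: cE_def)
      then show ?thesis using pD by linarith
    qed
    then show ?thesis by blast
  qed
  ultimately show ?thesis unfolding total_colorable_def by blast
qed

theorem theorem3p1:
  fixes n :: nat
  assumes "n > 1"
  shows "total_colorable (unitary_cayley_graph n) (max_degree (unitary_cayley_graph n) + 2)"
  using assms total_colorable_even total_colorable_odd by blast

end
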